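(* Let $n\ge1$, let $q$ be a nonzero indeterminate (or nonzero complex number) and let $h_q(w,y)=qw-q^{-1}y$ (so $h_1(w,y)=w-y$). Then $$\mathcal{AS}_{w_1,\dots,w_n}\left[\frac{\prod_{1\le i<j\le n}h_q(w_i,w_j)}{\prod_{1\le i\le j\le n}h_1(w_j,y_i)\prod_{1\le j\le i\le n}h_q(w_j,y_i)}\right]=\frac{\det_{1\le i,j\le n}\left(\frac{1}{h_1(w_i,y_j)h_q(w_i,y_j)}\right)}{\prod_{1\le i<j\le n}h_1(y_j,y_i)}$$ as rational functions in $w_1,\dots,w_n,y_1,\dots,y_n$.
   Context: The antisymmetrizer is $\mathcal{AS}_{w_1,\dots,w_n}p(w_1,\dots,w_n)=\sum_{\sigma\in\mathcal S_n}\operatorname{sgn}\sigma\,p(w_{\sigma(1)},\dots,w_{\sigma(n)})$, where $\mathcal S_n$ is the symmetric group. *)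

theory Defs
  imports
    "HOL-Library.Poly_Mapping"
    "HOL-Computational_Algebra.Fraction_Field"
    "HOL-Computational_Algebra.Polynomial"
    "HOL-Combinatorics.Permutations"
    "Jordan_Normal_Form.Determinant"
    Complex_Main
begin

text \<open>
  Rational functions over a field \<open>'k\<close> in countably many indeterminates, indexed by \<open>nat\<close>:
  the quotient field of the polynomial ring whose monomials are finitely supported exponent
  functions \<open>nat \<Rightarrow>\<^sub>0 nat\<close>. The even-numbered indeterminates serve as the \<open>w\<^sub>i\<close> and the
  odd-numbered ones as the \<open>y\<^sub>i\<close>. An identity between finitely many of them holds in
  \<open>'k(w\<^sub>1,\<dots>,w\<^sub>n,y\<^sub>1,\<dots>,y\<^sub>n)\<close> if and only if it holds here, as that is a subfield.
\<close>

type_synonym 'k ratfun = "((nat \<Rightarrow>\<^sub>0 nat) \<Rightarrow>\<^sub>0 'k) fract"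

definition rconst :: "'k::field \<Rightarrow> 'k ratfun" where
  "rconst c = Fract (Poly_Mapping.single 0 c) 1"

definition rvar :: "nat \<Rightarrow> 'k::field ratfun" where
  "rvar v = Fract (Poly_Mapping.single (Poly_Mapping.single v 1) 1) 1"

definition W :: "nat \<Rightarrow> 'k::field ratfun" where
  "W i = rvar (2 * i)"

definition Y :: "nat \<Rightarrow> 'k::field ratfun" where
  "Y i = rvar (2 * i + 1)"

text \<open>The generator of the field \<open>\<complex>(q)\<close>, for the reading of \<open>q\<close> as an indeterminate.\<close>

definition q_indet :: "complex poly fract" where
  "q_indet = Fract [:0, 1:] 1"

definition h :: "'a::field \<Rightarrow> 'a \<Rightarrow> 'a \<Rightarrow> 'a" where
  "h q w y = q * w - inverse q * y"

text \<open>
  The expression \<open>p\<close> is a function of the tuple \<open>(w\<^sub>1,\<dots>,w\<^sub>n)\<close>, given as a map on indices of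
  which only the values at \<open>1,\<dots>,n\<close> matter.
\<close>

definition antisymmetrizer ::
    "nat \<Rightarrow> ((nat \<Rightarrow> 'a) \<Rightarrow> 'a) \<Rightarrow> (nat \<Rightarrow> 'a) \<Rightarrow> 'a::comm_ring_1" where
  "antisymmetrizer n p w =
     (\<Sum>\<sigma> | \<sigma> permutes {1..n}. of_int (sign \<sigma>) * p (\<lambda>i. w (\<sigma> i)))"

end

theory Submission
  imports Defs
begin

text \<open>
  Split off the factors of the integrand that involve \<open>w\<^sub>n\<close> or \<open>y\<^sub>n\<close>. They are symmetric in
  \<open>w\<^sub>1,\<dots>,w\<^bsub>n-1\<^esub>\<close>, so by induction the remaining factors may be replaced, under the
  antisymmetrizer, by the diagonal product \<open>\<Prod>\<^sub>i f\<^sub>i(w\<^sub>i)\<close> with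
  \<open>f\<^sub>i(w) = 1 / (h\<^sub>1(w, y\<^sub>i) h\<^sub>q(w, y\<^sub>i))\<close>. Lagrange interpolation at \<open>y\<^sub>1,\<dots>,y\<^sub>n\<close> of
  \<open>z \<mapsto> \<Prod>\<^bsub>i<n\<^esub> h\<^sub>q(w\<^sub>i, z)\<close>, evaluated at \<open>z = w\<^sub>n\<close>, writes the split-off factors as
  \<open>\<Sum>\<^sub>j a\<^sub>j f\<^sub>j(w\<^sub>n)\<close> with coefficients \<open>a\<^sub>j\<close> symmetric in all of \<open>w\<^sub>1,\<dots>,w\<^sub>n\<close>. The terms with
  \<open>j < n\<close> antisymmetrize to determinants with two equal columns, and \<open>a\<^sub>n\<close> supplies the missing
  part of the Vandermonde denominator.
\<close>

lemma h_one [simp]: "h 1 x y = x - y"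
  by (simp add: h_def)

section \<open>Partial fractions by Lagrange interpolation\<close>

lemma lagrange_partial_fractions:
  fixes p :: "'a::field poly"
  assumes "finite S" "inj_on y S" "z \<notin> y ` S" "Polynomial.degree p < card S"
  shows "poly p z / (\<Prod>i\<in>S. z - y i)
       = (\<Sum>j\<in>S. poly p (y j) / ((z - y j) * (\<Prod>i\<in>S - {j}. y j - y i)))"
proof -
  \<comment> \<open>\<open>L\<close> is the interpolant: at node \<open>y k\<close>, every summand
    with index other than \<open>k\<close> contains the factor \<open>y k - y k\<close>.\<close>
  define L where "L = (\<Sum>j\<in>S. Polynomial.smult (poly p (y j) / (\<Prod>i\<in>S - {j}. y j - y i))
                        (\<Prod>i\<in>S - {j}. [:- y i, 1:]))"
  have poly_L: "poly L x = (\<Sum>j\<in>S. poly p (y j) / (\<Prod>i\<in>S - {j}. y j - y i)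
                                    * (\<Prod>i\<in>S - {j}. x - y i))" for x
    by (simp add: L_def poly_sum poly_prod)
  have "poly p x = poly L x" if "x \<in> y ` S" for x
  proof -
    from that obtain k where k: "k \<in> S" "x = y k" by blast
    have nz: "(\<Prod>i\<in>S - {k}. y k - y i) \<noteq> 0"
      using assms(1,2) k(1) by (auto simp: inj_on_def)
    have "poly L x = (\<Sum>j\<in>S. if j = k then poly p (y k) else 0)"
      unfolding poly_L
    proof (rule sum.cong[OF refl])
      fix j assume "j \<in> S"
      show "poly p (y j) / (\<Prod>i\<in>S - {j}. y j - y i) * (\<Prod>i\<in>S - {j}. x - y i)
          = (if j = k then poly p (y k) else 0)"
      proof (cases "j = k")
        case False
        then have "(\<Prod>i\<in>S - {j}. x - y i) = 0"
          using assms(1) k by auto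
        with False show ?thesis by simp
      qed (use nz k in simp)
    qed
    also have "\<dots> = poly p x"
      using assms(1) k by simp
    finally show ?thesis ..
  qed
  moreover have "card (y ` S) = card S"
    by (simp add: assms(2) card_image)
  moreover have "Polynomial.degree L < card S"
    unfolding L_def
  proof (rule degree_sum_less)
    fix j assume "j \<in> S"
    have "Polynomial.degree (\<Prod>i\<in>S - {j}. [:- y i, 1:]) = card (S - {j})"
      by (subst degree_prod_eq_sum_degree) auto
    also have "\<dots> < card S"
      using assms(1) \<open>j \<in> S\<close> by (rule card_Diff1_less)
    finally show "Polynomial.degree (Polynomial.smult (poly p (y j) / (\<Prod>i\<in>S - {j}. y j - y i))
                        (\<Prod>i\<in>S - {j}. [:- y i, 1:])) < card S"
      using degree_smult_le le_less_trans by blast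
  \<comment> \<open>What remains is that the degree bound \<open>card S\<close> is positive.\<close>
  qed (use assms(4) in simp)
  ultimately have "p = L"
    using assms(4) by (intro poly_eqI_degree[of "y ` S"]) auto
  then have "poly p z / (\<Prod>i\<in>S. z - y i) = poly L z / (\<Prod>i\<in>S. z - y i)"
    by simp
  also have "\<dots> = (\<Sum>j\<in>S. poly p (y j) / ((z - y j) * (\<Prod>i\<in>S - {j}. y j - y i)))"
    unfolding poly_L sum_divide_distrib
  proof (rule sum.cong[OF refl])
    fix j assume j: "j \<in> S"
    have "(\<Prod>i\<in>S. z - y i) = (z - y j) * (\<Prod>i\<in>S - {j}. z - y i)"
      using assms(1) j by (rule prod.remove)
    moreover have "(\<Prod>i\<in>S - {j}. z - y i) \<noteq> 0"
      using assms(1,3) by auto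
    ultimately show "poly p (y j) / (\<Prod>i\<in>S - {j}. y j - y i) * (\<Prod>i\<in>S - {j}. z - y i)
                       / (\<Prod>i\<in>S. z - y i)
                   = poly p (y j) / ((z - y j) * (\<Prod>i\<in>S - {j}. y j - y i))"
      by (simp add: mult.commute)
  qed
  finally show ?thesis .
qed

text \<open>The product over \<open>S - {k}\<close> is a polynomial in the second argument of
  \<open>h q\<close>, with one factor of degree at most 1 per index, so its degree is below
  \<open>card S\<close>. Inserting \<open>h q (w k) (y j)\<close> above and below in each term makes
  the numerator symmetric in all \<open>w i\<close> with \<open>i\<close> in
  \<open>S\<close>.\<close>

lemma h_prod_partial_fractions:
  fixes q :: "'a::field"
  assumes S: "finite S" "inj_on y S" and k: "k \<in> S"
    and good: "\<And>j. j \<in> S \<Longrightarrow> w k \<noteq> y j" "\<And>j. j \<in> S \<Longrightarrow> h q (w k) (y j) \<noteq> 0"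
  shows "(\<Prod>i\<in>S - {k}. h q (w i) (w k)) / (\<Prod>i\<in>S. w k - y i)
       = (\<Sum>j\<in>S. (\<Prod>i\<in>S. h q (w i) (y j)) / (\<Prod>i\<in>S - {j}. y j - y i)
                 * (1 / ((w k - y j) * h q (w k) (y j))))"
proof -
  define p where "p = (\<Prod>i\<in>S - {k}. [:q * w i, - inverse q:])"
  have poly_p: "poly p z = (\<Prod>i\<in>S - {k}. h q (w i) z)" for z
    by (simp add: p_def poly_prod h_def algebra_simps)
  have "Polynomial.degree p \<le> sum (Polynomial.degree \<circ> (\<lambda>i. [:q * w i, - inverse q:])) (S - {k})"
    unfolding p_def using S(1) by (intro degree_prod_sum_le) auto
  also have "\<dots> \<le> (\<Sum>i\<in>S - {k}. 1)"
    by (intro sum_mono) simp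
  also have "\<dots> < card S"
    using card_Diff1_less[OF S(1) k] by simp
  finally have deg: "Polynomial.degree p < card S" .
  have "(\<Prod>i\<in>S - {k}. h q (w i) (w k)) / (\<Prod>i\<in>S. w k - y i)
      = (\<Sum>j\<in>S. (\<Prod>i\<in>S - {k}. h q (w i) (y j)) / ((w k - y j) * (\<Prod>i\<in>S - {j}. y j - y i)))"
    using lagrange_partial_fractions[OF S _ deg, of "w k"] good(1) by (auto simp: poly_p)
  also have "\<dots> = (\<Sum>j\<in>S. (\<Prod>i\<in>S. h q (w i) (y j)) / (\<Prod>i\<in>S - {j}. y j - y i)
                 * (1 / ((w k - y j) * h q (w k) (y j))))"
  proof (rule sum.cong[OF refl])
    fix j assume "j \<in> S"
    have "(\<Prod>i\<in>S. h q (w i) (y j)) = h q (w k) (y j) * (\<Prod>i\<in>S - {k}. h q (w i) (y j))"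
      using S(1) k by (rule prod.remove)
    with good(2)[OF \<open>j \<in> S\<close>]
    show "(\<Prod>i\<in>S - {k}. h q (w i) (y j)) / ((w k - y j) * (\<Prod>i\<in>S - {j}. y j - y i))
        = (\<Prod>i\<in>S. h q (w i) (y j)) / (\<Prod>i\<in>S - {j}. y j - y i)
                 * (1 / ((w k - y j) * h q (w k) (y j)))"
      by (simp add: mult.commute)
  qed
  finally show ?thesis .
qed

section \<open>The antisymmetrizer: decomposition and determinants\<close>

text \<open>Agreement is asked for only on rearrangements of \<open>w\<close>, because the
  interpolation formula is available only where its denominators do not vanish.\<close>

lemma antisymmetrizer_cong:
  assumes "\<And>\<sigma>. \<sigma> permutes {1..n} \<Longrightarrow> p (\<lambda>i. w (\<sigma> i)) = p' (\<lambda>i. w (\<sigma> i))"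
  shows "antisymmetrizer n p w = antisymmetrizer n p' w"
  unfolding antisymmetrizer_def using assms by (intro sum.cong) auto

lemma antisymmetrizer_symmetric_factor:
  assumes "\<And>\<sigma>. \<sigma> permutes {1..n} \<Longrightarrow> c (\<lambda>i. w (\<sigma> i)) = c w"
  shows "antisymmetrizer n (\<lambda>w. c w * p w) w = c w * antisymmetrizer n p w"
  unfolding antisymmetrizer_def sum_distrib_left using assms
  by (intro sum.cong) (auto simp: mult_ac)

text \<open>Coset decomposition: a permutation of \<open>{1..Suc n}\<close> sending
  \<open>Suc n\<close> to \<open>b\<close> is uniquely \<open>transpose (Suc n) b\<close> composed
  with a permutation of \<open>{1..n}\<close>.\<close>

lemma antisymmetrizer_Suc:
  "antisymmetrizer (Suc n) p w
     = (\<Sum>b\<in>{1..Suc n}. of_int (sign (transpose (Suc n) b))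
                          * antisymmetrizer n p (\<lambda>i. w (transpose (Suc n) b i)))"
proof -
  have ins: "{1..Suc n} = insert (Suc n) {1..n}" by auto
  have sgn: "sign (transpose (Suc n) b \<circ> \<sigma>) = sign (transpose (Suc n) b) * sign \<sigma>"
    if "\<sigma> permutes {1..n}" for b \<sigma>
    using that by (intro sign_compose permutes_imp_permutation permutation_swap_id) auto
  have "antisymmetrizer (Suc n) p w
      = (\<Sum>b\<in>{1..Suc n}. \<Sum>\<sigma> | \<sigma> permutes {1..n}. of_int (sign (transpose (Suc n) b \<circ> \<sigma>))
           * p (\<lambda>i. w ((transpose (Suc n) b \<circ> \<sigma>) i)))"
    unfolding antisymmetrizer_def ins
    by (subst sum_over_permutations_insert) auto
  also have "\<dots> = (\<Sum>b\<in>{1..Suc n}. of_int (sign (transpose (Suc n) b))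
                          * antisymmetrizer n p (\<lambda>i. w (transpose (Suc n) b i)))"
    unfolding antisymmetrizer_def sum_distrib_left
    by (intro sum.cong refl) (auto simp: sgn mult_ac)
  finally show ?thesis .
qed

text \<open>This is the Leibniz formula in its column form, where the permutation acts on the row
  index and hence on the variables. The rest is the shift between matrix indices from 0 and variable
  indices from 1.\<close>

lemma antisymmetrizer_prod_eq_det:
  "antisymmetrizer n (\<lambda>w. \<Prod>i\<in>{1..n}. f i (w i)) w
     = det (mat n n (\<lambda>(i, j). f (Suc j) (w (Suc i))))"
proof -
  let ?up = "map_permutation {0..<n} Suc" and ?down = "map_permutation {1..n} (\<lambda>i. i - 1)"
  have bij: "bij_betw Suc {0..<n} {1..n}" "bij_betw (\<lambda>i. i - 1) {1..n} {0..<n}"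
    by (auto intro!: bij_betwI[where g = "\<lambda>i. i - 1"] bij_betwI[where g = Suc])
  have "det (mat n n (\<lambda>(i, j). f (Suc j) (w (Suc i))))
      = (\<Sum>\<pi> | \<pi> permutes {0..<n}. of_int (sign \<pi>)
           * (\<Prod>j<n. mat n n (\<lambda>(i, j). f (Suc j) (w (Suc i))) $$ (\<pi> j, j)))"
    by (rule det_col) simp
  also have "\<dots> = (\<Sum>\<pi> | \<pi> permutes {0..<n}. of_int (sign \<pi>) * (\<Prod>j<n. f (Suc j) (w (Suc (\<pi> j)))))"
    by (intro sum.cong prod.cong refl arg_cong2[where f = "(*)"])
       (auto simp: permutes_nat_less)
  also have "\<dots> = (\<Sum>\<sigma> | \<sigma> permutes {1..n}. of_int (sign \<sigma>) * (\<Prod>i\<in>{1..n}. f i (w (\<sigma> i))))"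
  proof (rule sum.reindex_bij_witness[where i = ?down and j = ?up])
    fix \<pi> assume "\<pi> \<in> {\<pi>. \<pi> permutes {0..<n}}"
    then have \<pi>: "\<pi> permutes {0..<n}" by simp
    show "?down (?up \<pi>) = \<pi>"
      by (rule map_permutation_compose_inv[OF bij(1) \<pi>]) simp
    show "?up \<pi> \<in> {\<sigma>. \<sigma> permutes {1..n}}"
      using map_permutation_permutes[OF bij(1) \<pi>] by simp
    have "(\<Prod>i\<in>{1..n}. f i (w (?up \<pi> i))) = (\<Prod>j\<in>{0..<n}. f (Suc j) (w (?up \<pi> (Suc j))))"
      by (rule prod.reindex_bij_betw[OF bij(1), symmetric])
    also have "\<dots> = (\<Prod>j<n. f (Suc j) (w (Suc (\<pi> j))))"
      by (intro prod.cong) (auto simp: map_permutation_apply)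
    finally show "of_int (sign (?up \<pi>)) * (\<Prod>i\<in>{1..n}. f i (w (?up \<pi> i)))
                = of_int (sign \<pi>) * (\<Prod>j<n. f (Suc j) (w (Suc (\<pi> j))))"
      using sign_map_permutation[OF _ \<pi>, of Suc] by simp
  next
    fix \<sigma> assume "\<sigma> \<in> {\<sigma>. \<sigma> permutes {1..n}}"
    then have \<sigma>: "\<sigma> permutes {1..n}" by simp
    show "?up (?down \<sigma>) = \<sigma>"
      by (rule map_permutation_compose_inv[OF bij(2) \<sigma>]) simp
    show "?down \<sigma> \<in> {\<pi>. \<pi> permutes {0..<n}}"
      using map_permutation_permutes[OF bij(2) \<sigma>] by simp
  qed
  finally show ?thesis
    by (simp add: antisymmetrizer_def)
qed

text \<open>Two columns of the associated matrix coincide. This removes all interpolation terms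
  except the top one.\<close>

lemma antisymmetrizer_prod_eq_0:
  assumes "k \<in> {1..n}" "l \<in> {1..n}" "k \<noteq> l" "f k = f l"
  shows "antisymmetrizer n (\<lambda>w. \<Prod>i\<in>{1..n}. f i (w i)) w = 0"
  unfolding antisymmetrizer_prod_eq_det
proof (rule det_identical_columns)
  show "k - 1 \<noteq> l - 1" "k - 1 < n" "l - 1 < n"
    using assms by auto
  then show "col (mat n n (\<lambda>(i, j). f (Suc j) (w (Suc i)))) (k - 1)
      = col (mat n n (\<lambda>(i, j). f (Suc j) (w (Suc i)))) (l - 1)"
    using assms by (intro eq_vecI) auto
qed simp

section \<open>Splitting the largest index off products over pairs\<close>

lemma prod_pairs_less_Suc:
  fixes g :: "nat \<Rightarrow> nat \<Rightarrow> 'a::comm_monoid_mult"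
  shows "(\<Prod>(i, j)\<in>{(i, j). 1 \<le> i \<and> i < j \<and> j \<le> Suc n}. g i j)
       = (\<Prod>(i, j)\<in>{(i, j). 1 \<le> i \<and> i < j \<and> j \<le> n}. g i j) * (\<Prod>i\<in>{1..n}. g i (Suc n))"
proof -
  have split: "{(i, j). 1 \<le> i \<and> i < j \<and> j \<le> Suc n}
      = {(i, j). 1 \<le> i \<and> i < j \<and> j \<le> n} \<union> (\<lambda>i. (i, Suc n)) ` {1..n}"
    by (auto simp: le_Suc_eq)
  have "finite {(i, j). 1 \<le> i \<and> i < j \<and> j \<le> n}"
    by (rule finite_subset[of _ "{1..n} \<times> {1..n}"]) auto
  moreover have "(\<Prod>(i, j)\<in>(\<lambda>i. (i, Suc n)) ` {1..n}. g i j) = (\<Prod>i\<in>{1..n}. g i (Suc n))"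
    by (subst prod.reindex) (auto simp: inj_on_def)
  ultimately show ?thesis
    unfolding split
    by (subst prod.union_disjoint) (auto simp del: One_nat_def prod.cl_ivl_Suc)
qed

lemma prod_pairs_le_Suc:
  fixes g :: "nat \<Rightarrow> nat \<Rightarrow> 'a::comm_monoid_mult"
  shows "(\<Prod>(i, j)\<in>{(i, j). 1 \<le> i \<and> i \<le> j \<and> j \<le> Suc n}. g i j)
       = (\<Prod>(i, j)\<in>{(i, j). 1 \<le> i \<and> i \<le> j \<and> j \<le> n}. g i j) * (\<Prod>i\<in>{1..Suc n}. g i (Suc n))"
proof -
  have split: "{(i, j). 1 \<le> i \<and> i \<le> j \<and> j \<le> Suc n}
      = {(i, j). 1 \<le> i \<and> i \<le> j \<and> j \<le> n} \<union> (\<lambda>i. (i, Suc n)) ` {1..Suc n}"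
    by (auto simp: le_Suc_eq)
  have "finite {(i, j). 1 \<le> i \<and> i \<le> j \<and> j \<le> n}"
    by (rule finite_subset[of _ "{1..n} \<times> {1..n}"]) auto
  moreover have "(\<Prod>(i, j)\<in>(\<lambda>i. (i, Suc n)) ` {1..Suc n}. g i j) = (\<Prod>i\<in>{1..Suc n}. g i (Suc n))"
    by (subst prod.reindex) (auto simp: inj_on_def)
  ultimately show ?thesis
    unfolding split
    by (subst prod.union_disjoint) (auto simp del: One_nat_def prod.cl_ivl_Suc)
qed

lemma prod_pairs_ge_Suc:
  fixes g :: "nat \<Rightarrow> nat \<Rightarrow> 'a::comm_monoid_mult"
  shows "(\<Prod>(i, j)\<in>{(i, j). 1 \<le> j \<and> j \<le> i \<and> i \<le> Suc n}. g i j)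
       = (\<Prod>(i, j)\<in>{(i, j). 1 \<le> j \<and> j \<le> i \<and> i \<le> n}. g i j) * (\<Prod>j\<in>{1..Suc n}. g (Suc n) j)"
proof -
  have "(\<Prod>(i, j)\<in>{(i, j). 1 \<le> j \<and> j \<le> i \<and> i \<le> m}. g i j)
      = (\<Prod>(i, j)\<in>{(i, j). 1 \<le> i \<and> i \<le> j \<and> j \<le> m}. g j i)" for m
    by (rule prod.reindex_bij_witness[where i = prod.swap and j = prod.swap]) auto
  then show ?thesis
    by (simp only: prod_pairs_le_Suc)
qed

section \<open>The identity over an arbitrary field, at points with nonvanishing
  denominators\<close>

context
  fixes q :: "'a::field" and y :: "nat \<Rightarrow> 'a"
begin

definition integrand :: "nat \<Rightarrow> (nat \<Rightarrow> 'a) \<Rightarrow> 'a" where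
  "integrand n w =
     (\<Prod>(i, j)\<in>{(i, j). 1 \<le> i \<and> i < j \<and> j \<le> n}. h q (w i) (w j)) /
       ((\<Prod>(i, j)\<in>{(i, j). 1 \<le> i \<and> i \<le> j \<and> j \<le> n}. h 1 (w j) (y i)) *
        (\<Prod>(i, j)\<in>{(i, j). 1 \<le> j \<and> j \<le> i \<and> i \<le> n}. h q (w j) (y i)))"

text \<open>For \<open>n \<ge> 1\<close>, these are the factors by which \<open>integrand n\<close>
  extends \<open>integrand (n - 1)\<close>.\<close>

definition top_factor :: "nat \<Rightarrow> (nat \<Rightarrow> 'a) \<Rightarrow> 'a" where
  "top_factor n w = (\<Prod>i\<in>{1..<n}. h q (w i) (w n)) /
     ((\<Prod>i\<in>{1..n}. w n - y i) * (\<Prod>i\<in>{1..n}. h q (w i) (y n)))"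

definition kernel :: "nat \<Rightarrow> 'a \<Rightarrow> 'a" where
  "kernel j x = 1 / (h 1 x (y j) * h q x (y j))"

text \<open>The coefficient \<open>a\<^sub>j\<close>, with \<open>kernel j\<close> as
  \<open>f\<^sub>j\<close>. The last product is the part of the denominator of
  \<open>top_factor\<close> that stays outside the interpolation; for \<open>j = n\<close> it equals
  the numerator.\<close>

definition lagrange_coeff :: "nat \<Rightarrow> (nat \<Rightarrow> 'a) \<Rightarrow> nat \<Rightarrow> 'a" where
  "lagrange_coeff n w j = (\<Prod>i\<in>{1..n}. h q (w i) (y j)) /
     ((\<Prod>i\<in>{1..n} - {j}. y j - y i) * (\<Prod>i\<in>{1..n}. h q (w i) (y n)))"

lemma integrand_Suc: "integrand (Suc n) w = top_factor (Suc n) w * integrand n w"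
  by (simp add: integrand_def top_factor_def prod_pairs_less_Suc prod_pairs_le_Suc
      prod_pairs_ge_Suc atLeastLessThanSuc_atLeastAtMost mult_ac
      del: One_nat_def prod.cl_ivl_Suc)

text \<open>As \<sigma> fixes \<open>Suc n\<close>, it only reorders the two products of values of
  \<open>h q\<close>. Thus \<open>top_factor (Suc n)\<close> can leave an antisymmetrizer over the
  first \<open>n\<close> variables.\<close>

lemma top_factor_permute:
  assumes "\<sigma> permutes {1..n}"
  shows "top_factor (Suc n) (\<lambda>i. w (\<sigma> i)) = top_factor (Suc n) w"
proof -
  have \<sigma>: "\<sigma> permutes {1..Suc n}"
    using assms by (rule permutes_subset) auto
  have "\<sigma> (Suc n) = Suc n"
    using assms by (simp add: permutes_def)
  then show ?thesis
    unfolding top_factor_def atLeastLessThanSuc_atLeastAtMost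
    using prod.permute[OF assms, of "\<lambda>i. h q (w i) (w (Suc n))"]
      prod.permute[OF \<sigma>, of "\<lambda>i. h q (w i) (y (Suc n))"]
    by (simp add: o_def del: prod.cl_ivl_Suc)
qed

text \<open>Here the symmetry includes the last variable, since \<open>w\<close> enters only through
  products over all of \<open>{1..n}\<close>.\<close>

lemma lagrange_coeff_permute:
  assumes "\<sigma> permutes {1..n}"
  shows "lagrange_coeff n (\<lambda>i. w (\<sigma> i)) = lagrange_coeff n w"
proof
  fix j
  have "(\<Prod>i\<in>{1..n}. h q (w (\<sigma> i)) z) = (\<Prod>i\<in>{1..n}. h q (w i) z)" for z
    using prod.permute[OF assms, of "\<lambda>i. h q (w i) z"] by (simp add: o_def)
  then show "lagrange_coeff n (\<lambda>i. w (\<sigma> i)) j = lagrange_coeff n w j"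
    by (simp add: lagrange_coeff_def)
qed

lemma top_factor_expansion:
  assumes "inj_on y {1..n}" "n \<ge> 1"
    and "\<And>j. j \<in> {1..n} \<Longrightarrow> w n \<noteq> y j" "\<And>j. j \<in> {1..n} \<Longrightarrow> h q (w n) (y j) \<noteq> 0"
  shows "top_factor n w = (\<Sum>j\<in>{1..n}. lagrange_coeff n w j * kernel j (w n))"
proof -
  have "{1..<n} = {1..n} - {n}" by auto
  then have "top_factor n w = (\<Prod>i\<in>{1..n} - {n}. h q (w i) (w n)) / (\<Prod>i\<in>{1..n}. w n - y i)
                                / (\<Prod>i\<in>{1..n}. h q (w i) (y n))"
    by (simp add: top_factor_def)
  also have "\<dots> = (\<Sum>j\<in>{1..n}. lagrange_coeff n w j * kernel j (w n))"
    using assms by (subst h_prod_partial_fractions)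
      (auto simp: sum_divide_distrib lagrange_coeff_def kernel_def mult_ac)
  finally show ?thesis .
qed

lemma antisymmetrizer_integrand:
  assumes "inj_on y {1..n}"
    and "\<And>i j. i \<in> {1..n} \<Longrightarrow> j \<in> {1..n} \<Longrightarrow> w i \<noteq> y j"
    and "\<And>i j. i \<in> {1..n} \<Longrightarrow> j \<in> {1..n} \<Longrightarrow> h q (w i) (y j) \<noteq> 0"
  shows "antisymmetrizer n (integrand n) w
       = antisymmetrizer n (\<lambda>w. \<Prod>i\<in>{1..n}. kernel i (w i)) w /
           (\<Prod>(i, j)\<in>{(i, j). 1 \<le> i \<and> i < j \<and> j \<le> n}. h 1 (y j) (y i))"
  using assms
\<comment> \<open>The tuple is generalized because the induction hypothesis is applied after
  transposing \<open>Suc n\<close> with each \<open>b\<close>.\<close>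
proof (induction n arbitrary: w)
  case 0
  have empty: "{(i, j). 1 \<le> i \<and> i < j \<and> j \<le> (0::nat)} = {}"
    "{(i, j). 1 \<le> i \<and> i \<le> j \<and> j \<le> (0::nat)} = {}"
    "{(i, j). 1 \<le> j \<and> j \<le> i \<and> i \<le> (0::nat)} = {}"
    by auto
  show ?case
    unfolding integrand_def[abs_def] empty by (simp add: antisymmetrizer_def)
next
  case (Suc n)
  let ?S = "{1..Suc n}"
  define V where "V m = (\<Prod>(i, j)\<in>{(i, j). 1 \<le> i \<and> i < j \<and> j \<le> m}. h 1 (y j) (y i))" for m
  define diag where "diag m v = (\<Prod>i\<in>{1..m}. kernel i (v i))" for m v
  let ?t = "\<lambda>b i. w (transpose (Suc n) b i)"
  have IH: "antisymmetrizer n (integrand n) (?t b) = antisymmetrizer n (diag n) (?t b) / V n"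
    if "b \<in> ?S" for b
    unfolding V_def diag_def
  proof (rule Suc.IH)
    have tr: "transpose (Suc n) b i \<in> ?S" if "i \<in> {1..n}" for i
      using that \<open>b \<in> ?S\<close> by (auto simp: transpose_def)
    show "inj_on y {1..n}"
      by (rule inj_on_subset[OF Suc.prems(1)]) auto
    show "?t b i \<noteq> y j" if "i \<in> {1..n}" "j \<in> {1..n}" for i j
      using tr that by (intro Suc.prems(2)) auto
    show "h q (?t b i) (y j) \<noteq> 0" if "i \<in> {1..n}" "j \<in> {1..n}" for i j
      using tr that by (intro Suc.prems(3)) auto
  qed
  have split_top: "antisymmetrizer (Suc n) (\<lambda>v. top_factor (Suc n) v * p v) w
      = (\<Sum>b\<in>?S. of_int (sign (transpose (Suc n) b))
                   * (top_factor (Suc n) (?t b) * antisymmetrizer n p (?t b)))" for p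
    unfolding antisymmetrizer_Suc
    by (intro sum.cong refl arg_cong2[where f = "(*)"]
        antisymmetrizer_symmetric_factor top_factor_permute)
  have other: "antisymmetrizer (Suc n) (\<lambda>v. kernel j (v (Suc n)) * diag n v) w
             = (if j = Suc n then antisymmetrizer (Suc n) (diag (Suc n)) w else 0)"
    if "j \<in> ?S" for j
  proof (cases "j = Suc n")
    case False
    \<comment> \<open>Slot \<open>Suc n\<close> receives \<open>kernel j\<close>, which already
      occupies slot \<open>j\<close>, so \<open>f j = f (Suc n)\<close>.\<close>
    define f where "f i = kernel (if i = Suc n then j else i)" for i
    have "(\<lambda>v. kernel j (v (Suc n)) * diag n v) = (\<lambda>v. \<Prod>i\<in>?S. f i (v i))"
      by (auto simp: fun_eq_iff diag_def f_def intro!: prod.cong)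
    moreover have "antisymmetrizer (Suc n) (\<lambda>v. \<Prod>i\<in>?S. f i (v i)) w = 0"
      using that False by (intro antisymmetrizer_prod_eq_0[of j _ "Suc n"]) (auto simp: f_def)
    ultimately show ?thesis
      using False by simp
  qed (simp add: diag_def[abs_def] mult.commute)
  \<comment> \<open>The products of \<open>h q\<close> cancel, leaving the reciprocal of the new
    factors of the Vandermonde product.\<close>
  have coeff_top: "lagrange_coeff (Suc n) w (Suc n) = 1 / (\<Prod>i\<in>{1..n}. y (Suc n) - y i)"
  proof -
    have "?S - {Suc n} = {1..n}" by auto
    moreover have "(\<Prod>i\<in>?S. h q (w i) (y (Suc n))) \<noteq> 0"
      using Suc.prems(3) by (subst prod_zero_iff) auto
    ultimately show ?thesis
      by (simp add: lagrange_coeff_def del: prod.cl_ivl_Suc)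
  qed
  have "antisymmetrizer (Suc n) (integrand (Suc n)) w
      = antisymmetrizer (Suc n) (\<lambda>v. top_factor (Suc n) v * integrand n v) w"
    by (simp add: integrand_Suc[abs_def])
  also have "\<dots> = antisymmetrizer (Suc n) (\<lambda>v. top_factor (Suc n) v * diag n v) w / V n"
    \<comment> \<open>Both sides are decomposed over \<open>b\<close>; the induction hypothesis then
      applies termwise, and its denominator \<open>V n\<close> does not depend on
      \<open>b\<close>.\<close>
    unfolding split_top sum_divide_distrib by (intro sum.cong refl) (simp add: IH)
  also have "antisymmetrizer (Suc n) (\<lambda>v. top_factor (Suc n) v * diag n v) w
      = antisymmetrizer (Suc n)
          (\<lambda>v. (\<Sum>j\<in>?S. lagrange_coeff (Suc n) w j * kernel j (v (Suc n))) * diag n v) w"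
  proof (rule antisymmetrizer_cong)
    fix \<sigma> assume \<sigma>: "\<sigma> permutes ?S"
    then have "\<sigma> (Suc n) \<in> ?S"
      by (subst permutes_in_image) auto
    then have "top_factor (Suc n) (\<lambda>i. w (\<sigma> i))
        = (\<Sum>j\<in>?S. lagrange_coeff (Suc n) (\<lambda>i. w (\<sigma> i)) j * kernel j (w (\<sigma> (Suc n))))"
      using Suc.prems by (intro top_factor_expansion) auto
    then show "top_factor (Suc n) (\<lambda>i. w (\<sigma> i)) * diag n (\<lambda>i. w (\<sigma> i))
        = (\<Sum>j\<in>?S. lagrange_coeff (Suc n) w j * kernel j (w (\<sigma> (Suc n)))) * diag n (\<lambda>i. w (\<sigma> i))"
      \<comment> \<open>Symmetry freezes the coefficients at the original \<open>w\<close>, so they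
        are constants for the antisymmetrizer and come out by linearity.\<close>
      by (simp only: lagrange_coeff_permute[OF \<sigma>])
  qed
  also have "\<dots> = (\<Sum>j\<in>?S. lagrange_coeff (Suc n) w j
                     * antisymmetrizer (Suc n) (\<lambda>v. kernel j (v (Suc n)) * diag n v) w)"
    unfolding antisymmetrizer_def sum_distrib_left sum_distrib_right
    by (subst sum.swap) (simp add: mult_ac del: sum.cl_ivl_Suc)
  also have "\<dots> = (\<Sum>j\<in>?S. if j = Suc n
      then lagrange_coeff (Suc n) w j * antisymmetrizer (Suc n) (diag (Suc n)) w else 0)"
    by (intro sum.cong refl) (simp add: other)
  also have "\<dots> = antisymmetrizer (Suc n) (diag (Suc n)) w / (\<Prod>i\<in>{1..n}. y (Suc n) - y i)"
    by (subst sum.delta) (auto simp: coeff_top)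
  also have "\<dots> / V n = antisymmetrizer (Suc n) (diag (Suc n)) w / V (Suc n)"
    by (simp add: V_def prod_pairs_less_Suc mult.commute del: One_nat_def)
  finally show ?case
    unfolding V_def diag_def .
qed

lemma antisymmetrizer_integrand_eq_det:
  assumes "inj_on y {1..n}"
    and "\<And>i j. i \<in> {1..n} \<Longrightarrow> j \<in> {1..n} \<Longrightarrow> w i \<noteq> y j"
    and "\<And>i j. i \<in> {1..n} \<Longrightarrow> j \<in> {1..n} \<Longrightarrow> h q (w i) (y j) \<noteq> 0"
  shows "antisymmetrizer n
           (\<lambda>w. (\<Prod>(i, j)\<in>{(i, j). 1 \<le> i \<and> i < j \<and> j \<le> n}. h q (w i) (w j)) /
                ((\<Prod>(i, j)\<in>{(i, j). 1 \<le> i \<and> i \<le> j \<and> j \<le> n}. h 1 (w j) (y i)) *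
                 (\<Prod>(i, j)\<in>{(i, j). 1 \<le> j \<and> j \<le> i \<and> i \<le> n}. h q (w j) (y i)))) w
       = det (mat n n (\<lambda>(i, j). 1 / (h 1 (w (Suc i)) (y (Suc j)) * h q (w (Suc i)) (y (Suc j))))) /
           (\<Prod>(i, j)\<in>{(i, j). 1 \<le> i \<and> i < j \<and> j \<le> n}. h 1 (y j) (y i))"
proof -
  have "antisymmetrizer n (integrand n) w
      = det (mat n n (\<lambda>(i, j). kernel (Suc j) (w (Suc i)))) /
          (\<Prod>(i, j)\<in>{(i, j). 1 \<le> i \<and> i < j \<and> j \<le> n}. h 1 (y j) (y i))"
    using assms by (subst antisymmetrizer_integrand) (auto simp only: antisymmetrizer_prod_eq_det)
  then show ?thesis
    unfolding integrand_def[abs_def] kernel_def .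
qed

end

section \<open>Nonvanishing of the denominators for indeterminates\<close>

text \<open>The right side has the nonzero coefficient \<open>d\<close> at the monomial of variable
  \<open>b\<close>, so both sides have the same monomial; its exponents then identify the
  variable.\<close>

lemma single_var_eq_iff:
  fixes c d :: "'k::field"
  assumes "d \<noteq> 0"
  shows "Poly_Mapping.single (Poly_Mapping.single a (1::nat)) c
           = Poly_Mapping.single (Poly_Mapping.single b 1) d \<longleftrightarrow> a = b \<and> c = d"
proof
  assume eq: "Poly_Mapping.single (Poly_Mapping.single a (1::nat)) c
           = Poly_Mapping.single (Poly_Mapping.single b 1) d"
  have "Poly_Mapping.lookup (Poly_Mapping.single (Poly_Mapping.single a (1::nat)) c)
          (Poly_Mapping.single b 1) \<noteq> 0"
    unfolding eq using assms by simp
  then have ab: "Poly_Mapping.single a (1::nat) = Poly_Mapping.single b 1"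
    by (metis lookup_single_not_eq)
  have "Poly_Mapping.lookup (Poly_Mapping.single a (1::nat)) b \<noteq> 0"
    unfolding ab by simp
  then have "a = b"
    by (metis lookup_single_not_eq)
  with eq show "a = b \<and> c = d"
    by (metis lookup_single_eq)
qed simp

lemma rvar_eq_iff: "(rvar a :: 'k::field ratfun) = rvar b \<longleftrightarrow> a = b"
  by (simp add: rvar_def eq_fract single_var_eq_iff del: One_nat_def)

lemma rconst_neq_0:
  assumes "c \<noteq> 0"
  shows "rconst c \<noteq> 0"
proof -
  have "Poly_Mapping.single (0 :: nat \<Rightarrow>\<^sub>0 nat) c \<noteq> 0"
    using assms lookup_single_eq[of "0 :: nat \<Rightarrow>\<^sub>0 nat" c] by fastforce
  then show ?thesis
    by (simp add: rconst_def Zero_fract_def eq_fract)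
qed

text \<open>Multiplying by \<open>q\<close> turns a zero into an equality between a scalar multiple
  of one variable and another variable, whose monomials differ.\<close>

lemma h_rconst_rvar_neq_0:
  fixes q :: "'k::field"
  assumes "q \<noteq> 0" "a \<noteq> b"
  shows "h (rconst q) (rvar a) (rvar b) \<noteq> 0"
proof
  assume "h (rconst q) (rvar a) (rvar b) = 0"
  then have "rconst q * rconst q * rvar a = rvar b"
    using rconst_neq_0[OF assms(1)] by (simp add: h_def field_simps)
  then have "Poly_Mapping.single (Poly_Mapping.single a (1::nat)) (q * q)
           = Poly_Mapping.single (Poly_Mapping.single b 1) 1"
    by (simp add: rconst_def rvar_def eq_fract mult_single)
  with assms show False
    by (simp add: single_var_eq_iff del: One_nat_def)
qed

text \<open>Distinct indeterminates satisfy every nondegeneracy condition. The coefficient field is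
  kept arbitrary so that a complex \<open>q\<close> and an indeterminate \<open>q\<close> are both
  instances.\<close>

lemma antisymmetrizer_ratfun:
  fixes q :: "'k::field"
  assumes "q \<noteq> 0"
  shows "antisymmetrizer n
           (\<lambda>w. (\<Prod>(i, j)\<in>{(i, j). 1 \<le> i \<and> i < j \<and> j \<le> n}. h (rconst q) (w i) (w j)) /
                ((\<Prod>(i, j)\<in>{(i, j). 1 \<le> i \<and> i \<le> j \<and> j \<le> n}. h 1 (w j) (Y i)) *
                 (\<Prod>(i, j)\<in>{(i, j). 1 \<le> j \<and> j \<le> i \<and> i \<le> n}. h (rconst q) (w j) (Y i))))
           W
         = det (mat n n (\<lambda>(i, j). 1 / (h 1 (W (Suc i)) (Y (Suc j)) *
                                      h (rconst q) (W (Suc i)) (Y (Suc j))))) /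
           (\<Prod>(i, j)\<in>{(i, j). 1 \<le> i \<and> i < j \<and> j \<le> n}. h 1 (Y j) (Y i))"
proof (rule antisymmetrizer_integrand_eq_det)
  show "inj_on (Y :: nat \<Rightarrow> 'k ratfun) {1..n}"
    by (auto simp: inj_on_def Y_def rvar_eq_iff)
  have parity: "2 * i \<noteq> 2 * j + 1" for i j :: nat
    by presburger
  show "(W i :: 'k ratfun) \<noteq> Y j" for i j
    unfolding W_def Y_def rvar_eq_iff by (rule parity)
  show "h (rconst q) (W i) (Y j) \<noteq> 0" for i j
    unfolding W_def Y_def using assms parity by (rule h_rconst_rvar_neq_0)
qed

theorem theorem5p3:
  fixes n :: nat
  assumes "n \<ge> 1"
  shows "(\<forall>q::complex. q \<noteq> 0 \<longrightarrow>
         antisymmetrizer n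
           (\<lambda>w. (\<Prod>(i, j)\<in>{(i, j). 1 \<le> i \<and> i < j \<and> j \<le> n}. h (rconst q) (w i) (w j)) /
                ((\<Prod>(i, j)\<in>{(i, j). 1 \<le> i \<and> i \<le> j \<and> j \<le> n}. h 1 (w j) (Y i)) *
                 (\<Prod>(i, j)\<in>{(i, j). 1 \<le> j \<and> j \<le> i \<and> i \<le> n}. h (rconst q) (w j) (Y i))))
           W
         = det (mat n n (\<lambda>(i, j). 1 / (h 1 (W (Suc i)) (Y (Suc j)) *
                                      h (rconst q) (W (Suc i)) (Y (Suc j))))) /
           (\<Prod>(i, j)\<in>{(i, j). 1 \<le> i \<and> i < j \<and> j \<le> n}. h 1 (Y j) (Y i)))
       \<and>
         antisymmetrizer n
           (\<lambda>w. (\<Prod>(i, j)\<in>{(i, j). 1 \<le> i \<and> i < j \<and> j \<le> n}. h (rconst q_indet) (w i) (w j)) /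
                ((\<Prod>(i, j)\<in>{(i, j). 1 \<le> i \<and> i \<le> j \<and> j \<le> n}. h 1 (w j) (Y i)) *
                 (\<Prod>(i, j)\<in>{(i, j). 1 \<le> j \<and> j \<le> i \<and> i \<le> n}. h (rconst q_indet) (w j) (Y i))))
           W
         = det (mat n n (\<lambda>(i, j). 1 / (h 1 (W (Suc i)) (Y (Suc j)) *
                                      h (rconst q_indet) (W (Suc i)) (Y (Suc j))))) /
           (\<Prod>(i, j)\<in>{(i, j). 1 \<le> i \<and> i < j \<and> j \<le> n}. h 1 (Y j) (Y i))"
proof -
  \<comment> \<open>The second conjunct is the instance whose coefficient field is the field of
    rational functions in \<open>q\<close>.\<close>
  have "q_indet \<noteq> 0"
    by (simp add: q_indet_def Zero_fract_def eq_fract)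
  then show ?thesis
    by (intro conjI allI impI antisymmetrizer_ratfun)
qed

end
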